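(* Suppose $(\mathsf P,\mathsf{Opens})$ is an intertwined-complete quasiregular semitopology. Then: \begin{enumerate} \item For every $p\in\mathsf P$ there exists some regular $q\in K(p)$. \item $\mathsf P$ contains a regular point. \end{enumerate}
   Context: A semitopology is a pair $(\mathsf P,\mathsf{Opens})$ with $\mathsf{Opens}\subseteq\mathcal P(\mathsf P)$ containing $\varnothing$ and $\mathsf P$ and closed under arbitrary unions. Points $p,p'$ are intertwined when every open neighbourhood of $p$ intersects every open neighbourhood of $p'$; $p_{\between}$ denotes the set of points intertwined with $p$. $\mathrm{interior}(X)$ is the union of open sets contained in $X$. The community of $p$ is $K(p)=\mathrm{interior}(p_{\between})$. $p$ is quasiregular when $K(p)\neq\varnothing$, and the semitopology is quasiregular when every point is. $p$ is regular when $p\in K(p)$ and $K(p)$ is nonempty, open and transitive (for all open $O,O'$, if $O\cap K(p)\neq\varnothing$ and $K(p)\cap O'\neq\varnothing$ then $O\cap O'\neq\varnothing$). The intertwined preorder is $p\le p'$ when $p_{\between}\subseteq p'_{\between}$; the semitopology is intertwined-complete when for every subset $P\subseteq\mathsf P$ totally ordered by this preorder there exists $p\in\mathsf P$ with $p_{\between}\subseteq\bigcap\{p'_{\between}\mid p'\in P\}$. *)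

theory Defs
  imports Main
begin

definition semitopology :: "'a set \<Rightarrow> 'a set set \<Rightarrow> bool" where
  "semitopology P Opens \<longleftrightarrow>
     Opens \<subseteq> Pow P \<and> {} \<in> Opens \<and> P \<in> Opens \<and> (\<forall>\<O>. \<O> \<subseteq> Opens \<longrightarrow> \<Union>\<O> \<in> Opens)"

definition intertwined :: "'a set set \<Rightarrow> 'a \<Rightarrow> 'a \<Rightarrow> bool" where
  "intertwined Opens p p' \<longleftrightarrow>
     (\<forall>U\<in>Opens. \<forall>V\<in>Opens. p \<in> U \<and> p' \<in> V \<longrightarrow> U \<inter> V \<noteq> {})"

definition intertwined_set :: "'a set \<Rightarrow> 'a set set \<Rightarrow> 'a \<Rightarrow> 'a set" where
  "intertwined_set P Opens p = {p' \<in> P. intertwined Opens p p'}"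

definition semi_interior :: "'a set set \<Rightarrow> 'a set \<Rightarrow> 'a set" where
  "semi_interior Opens X = \<Union>{U \<in> Opens. U \<subseteq> X}"

definition community :: "'a set \<Rightarrow> 'a set set \<Rightarrow> 'a \<Rightarrow> 'a set" where
  "community P Opens p = semi_interior Opens (intertwined_set P Opens p)"

definition quasiregular_point :: "'a set \<Rightarrow> 'a set set \<Rightarrow> 'a \<Rightarrow> bool" where
  "quasiregular_point P Opens p \<longleftrightarrow> community P Opens p \<noteq> {}"

definition quasiregular :: "'a set \<Rightarrow> 'a set set \<Rightarrow> bool" where
  "quasiregular P Opens \<longleftrightarrow> (\<forall>p\<in>P. quasiregular_point P Opens p)"

definition transitive_set :: "'a set set \<Rightarrow> 'a set \<Rightarrow> bool" where
  "transitive_set Opens T \<longleftrightarrow>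
     (\<forall>U\<in>Opens. \<forall>V\<in>Opens. U \<inter> T \<noteq> {} \<and> T \<inter> V \<noteq> {} \<longrightarrow> U \<inter> V \<noteq> {})"

definition regular_point :: "'a set \<Rightarrow> 'a set set \<Rightarrow> 'a \<Rightarrow> bool" where
  "regular_point P Opens p \<longleftrightarrow>
     p \<in> community P Opens p \<and> community P Opens p \<noteq> {} \<and>
     community P Opens p \<in> Opens \<and> transitive_set Opens (community P Opens p)"

definition intertwined_le :: "'a set \<Rightarrow> 'a set set \<Rightarrow> 'a \<Rightarrow> 'a \<Rightarrow> bool" where
  "intertwined_le P Opens p p' \<longleftrightarrow> intertwined_set P Opens p \<subseteq> intertwined_set P Opens p'"

text \<open>The chain \<^term>\<open>C\<close> may be empty, in which case the intersection is \<^term>\<open>UNIV\<close> and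
  the condition just says that \<^term>\<open>P\<close> is nonempty.  Totality is that of a preorder: distinct
  members of \<^term>\<open>C\<close> may lie below each other.\<close>

definition intertwined_complete :: "'a set \<Rightarrow> 'a set set \<Rightarrow> bool" where
  "intertwined_complete P Opens \<longleftrightarrow>
     (\<forall>C. C \<subseteq> P \<and> Complete_Partial_Order.chain (intertwined_le P Opens) C \<longrightarrow>
        (\<exists>p\<in>P. intertwined_set P Opens p \<subseteq> (\<Inter>p'\<in>C. intertwined_set P Opens p')))"

end

theory Submission imports Defs begin

text \<open>Every point \<open>q\<close> of \<open>K(m)\<close> satisfies \<open>q \<le> m\<close> in the intertwined preorder. Hence, if \<open>m\<close> is
  minimal, all points of \<open>K(m)\<close> have the same intertwined set as \<open>m\<close>; so they are pairwise
  intertwined and share the community \<open>K(m)\<close>, i.e. they are regular. Completeness and Zorn's lemma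
  provide a minimal \<open>m \<le> p\<close>, and quasiregularity makes \<open>K(m) \<subseteq> K(p)\<close> nonempty.\<close>

lemma community_subset_intertwined_set:
  "community P Opens p \<subseteq> intertwined_set P Opens p"
  by (auto simp: community_def semi_interior_def)

lemma community_open:
  assumes "semitopology P Opens"
  shows "community P Opens p \<in> Opens"
proof -
  have "{U \<in> Opens. U \<subseteq> intertwined_set P Opens p} \<subseteq> Opens" by blast
  with assms show ?thesis
    unfolding semitopology_def community_def semi_interior_def by blast
qed

lemma community_mono:
  assumes "intertwined_le P Opens p q"
  shows "community P Opens p \<subseteq> community P Opens q"
  using assms by (auto simp: intertwined_le_def community_def semi_interior_def)

text \<open>The open set \<open>community P Opens m\<close> is a neighbourhood of \<open>q\<close>,
  so every open neighbourhood \<open>V\<close> of a point \<open>r\<close> intertwined with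
  \<open>q\<close> meets it. A common point \<open>y\<close> is intertwined with \<open>m\<close>,
  hence \<open>V\<close>, as a neighbourhood of \<open>y\<close>, meets every open neighbourhood of
  \<open>m\<close>.\<close>

lemma intertwined_le_if_in_community:
  assumes "semitopology P Opens" and q: "q \<in> community P Opens m"
  shows "intertwined_le P Opens q m"
  unfolding intertwined_le_def
proof
  fix r assume r: "r \<in> intertwined_set P Opens q"
  have "U \<inter> V \<noteq> {}" if "U \<in> Opens" "V \<in> Opens" "m \<in> U" "r \<in> V" for U V
  proof -
    have "community P Opens m \<inter> V \<noteq> {}"
      using r q that community_open[OF assms(1)]
      unfolding intertwined_set_def intertwined_def by blast
    then obtain y where "y \<in> V" "y \<in> intertwined_set P Opens m"
      using community_subset_intertwined_set[of P Opens m] by blast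
    with that show ?thesis
      unfolding intertwined_set_def intertwined_def by blast
  qed
  with r show "r \<in> intertwined_set P Opens m"
    by (simp add: intertwined_set_def intertwined_def)
qed

lemma regular_point_if_minimal:
  assumes st: "semitopology P Opens"
    and min: "\<And>x. \<lbrakk>x \<in> P; intertwined_le P Opens x m\<rbrakk> \<Longrightarrow> intertwined_le P Opens m x"
    and q: "q \<in> community P Opens m"
  shows "regular_point P Opens q"
proof -
  have sub: "community P Opens m \<subseteq> intertwined_set P Opens m"
    by (rule community_subset_intertwined_set)
  have eq: "intertwined_set P Opens x = intertwined_set P Opens m"
    if "x \<in> community P Opens m" for x
  proof -
    have "x \<in> P" using that sub by (auto simp: intertwined_set_def)
    moreover have "intertwined_le P Opens x m"
      using st that by (rule intertwined_le_if_in_community)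
    ultimately show ?thesis using min by (auto simp: intertwined_le_def)
  qed
  have "community P Opens q = community P Opens m"
    using eq[OF q] by (simp add: community_def)
  moreover have "U \<inter> V \<noteq> {}"
    if "U \<in> Opens" "V \<in> Opens" "u \<in> U" "u \<in> community P Opens m"
      "v \<in> V" "v \<in> community P Opens m" for U V u v
  proof -
    \<comment> \<open>By \<open>sub\<close>, \<open>v\<close> is intertwined with \<open>m\<close>;
      by \<open>eq\<close>, \<open>u\<close> has the same intertwined set as
      \<open>m\<close>.\<close>
    have "v \<in> intertwined_set P Opens u" using eq that sub by blast
    with that show ?thesis unfolding intertwined_set_def intertwined_def by blast
  qed
  then have "transitive_set Opens (community P Opens m)"
    unfolding transitive_set_def by blast
  ultimately show ?thesis
    using q community_open[OF st] unfolding regular_point_def by auto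
qed

lemma minimal_point_exists:
  assumes complete: "intertwined_complete P Opens" and p: "p \<in> P"
  obtains m where "m \<in> P" "intertwined_le P Opens m p"
    "\<And>x. \<lbrakk>x \<in> P; intertwined_le P Opens x m\<rbrakk> \<Longrightarrow> intertwined_le P Opens m x"
proof -
  let ?I = "intertwined_set P Opens"
  let ?A = "{?I x | x. x \<in> P \<and> ?I x \<subseteq> ?I p}"
  \<comment> \<open>\<open>predicate_Zorn\<close> yields maximal elements, so inclusion is reversed
    and upper bounds of chains become lower bounds.\<close>
  let ?ge = "\<lambda>X Y :: 'a set. Y \<subseteq> X"
  have "\<exists>M\<in>?A. \<forall>X\<in>?A. ?ge M X \<longrightarrow> X = M"
  proof (rule predicate_Zorn)
    show "partial_order_on ?A (relation_of ?ge ?A)"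
      by (rule partial_order_on_relation_ofI) auto
  next
    fix C assume C: "C \<in> Chains (relation_of ?ge ?A)"
    have CA: "C \<subseteq> ?A" using C unfolding Chains_def relation_of_def by blast
    have tot: "X \<subseteq> Y \<or> Y \<subseteq> X" if "X \<in> C" "Y \<in> C" for X Y
      using C that unfolding Chains_def relation_of_def by blast
    show "\<exists>M\<in>?A. \<forall>X\<in>C. ?ge X M"
    \<comment> \<open>For empty \<open>C\<close>, completeness would give a point unrelated to
      \<open>p\<close>; here \<open>?I p\<close> itself is a bound.\<close>
    proof (cases "C = {}")
      case True
      with p show ?thesis by blast
    next
      case False
      \<comment> \<open>Completeness speaks of points, so \<open>C\<close> is pulled back to all
        points whose intertwined set it contains.\<close>
      let ?S = "{x \<in> P. ?I x \<in> C}"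
      have "Complete_Partial_Order.chain (intertwined_le P Opens) ?S"
        using tot by (auto simp: chain_def intertwined_le_def)
      then obtain q where q: "q \<in> P" "?I q \<subseteq> (\<Inter>x\<in>?S. ?I x)"
        using complete unfolding intertwined_complete_def by (metis (no_types, lifting) mem_Collect_eq subsetI)
      have low: "?I q \<subseteq> X" if X: "X \<in> C" for X
      proof -
        obtain x where "x \<in> P" "X = ?I x" using X CA by blast
        with X q(2) show ?thesis by blast
      qed
      \<comment> \<open>Any member of \<open>C\<close> puts \<open>q\<close> below \<open>p\<close>,
        so that the bound \<open>?I q\<close> belongs to \<open>?A\<close>.\<close>
      obtain X where "X \<in> C" "X \<subseteq> ?I p" using False CA by blast
      with low have "?I q \<subseteq> ?I p" by blast
      with q(1) low show ?thesis by blast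
    qed
  qed
  then obtain m where m: "m \<in> P" "?I m \<subseteq> ?I p"
    and min: "\<forall>X\<in>?A. X \<subseteq> ?I m \<longrightarrow> X = ?I m" by auto
  show thesis
  proof (rule that)
    fix x assume "x \<in> P" "intertwined_le P Opens x m"
    then have "?I x \<in> ?A" "?I x \<subseteq> ?I m" using m(2) by (auto simp: intertwined_le_def)
    with min show "intertwined_le P Opens m x" unfolding intertwined_le_def by blast
  qed (use m in \<open>simp_all add: intertwined_le_def\<close>)
qed

theorem theorem6p18:
  fixes P :: "'a set" and Opens :: "'a set set"
  assumes "semitopology P Opens"
    and "intertwined_complete P Opens"
    and "quasiregular P Opens"
  shows "(\<forall>p\<in>P. \<exists>q\<in>community P Opens p. regular_point P Opens q) \<and>
         (\<exists>q\<in>P. regular_point P Opens q)"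
proof -
  have *: "\<exists>q\<in>community P Opens p. regular_point P Opens q" if p: "p \<in> P" for p
  proof -
    obtain m where m: "m \<in> P" "intertwined_le P Opens m p"
      and min: "\<And>x. \<lbrakk>x \<in> P; intertwined_le P Opens x m\<rbrakk> \<Longrightarrow> intertwined_le P Opens m x"
      using minimal_point_exists[OF assms(2) p] by blast
    obtain q where q: "q \<in> community P Opens m"
      using assms(3) m(1) unfolding quasiregular_def quasiregular_point_def by blast
    have "regular_point P Opens q"
      using assms(1) min q by (rule regular_point_if_minimal)
    with q community_mono[OF m(2)] show ?thesis by blast
  qed
  \<comment> \<open>Completeness for the empty chain.\<close>
  have "Complete_Partial_Order.chain (intertwined_le P Opens) {}"
    by (simp add: chain_def)
  then obtain p where "p \<in> P"
    using assms(2) unfolding intertwined_complete_def by blast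
  then obtain q where "q \<in> community P Opens p" "regular_point P Opens q"
    using * by blast
  moreover have "community P Opens p \<subseteq> P"
    using community_subset_intertwined_set[of P Opens p] by (auto simp: intertwined_set_def)
  ultimately show ?thesis using * by blast
qed

end
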